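(* Let the maximum-entropy reference and the base point of the exponential family $\mathcal E$ be the same density $p_0$, and take the maximum-entropy target to be the empirical moment $\hat c$. Assume that the exponential family is regular and minimal modulo the null space $\mathcal N$, that $\hat c$ lies in the relative interior of the attainable moment set, and that the log-partition function is finite in a neighborhood of the optimal parameter. Then the e-projection of $p_0$ onto $\mathcal M(\hat c)$ (the minimizer of $\mathrm{KL}(p\,\|\,p_0)$ over $p\in\mathcal M(\hat c)$) and the m-projection of $\hat p$ onto $\mathcal E$ (the minimizer of $\mathrm{KL}(\hat p\,\|\,q)$ over $q\in\mathcal E$, i.e. the maximum-likelihood fit) coincide. Their common value is the unique distribution $p_{\hat\lambda}\in\mathcal E\cap\mathcal M(\hat c)$ (uniqueness up to $\mu$-a.e. equality). Moreover, for every $p\in\mathcal M(\hat c)$ and every $q\in\mathcal E$, $$\mathrm{KL}(p\,\|\,p_0)=\mathrm{KL}(p\,\|\,p_{\hat\lambda})+\mathrm{KL}(p_{\hat\lambda}\,\|\,p_0),\qquad \mathrm{KL}(\hat p\,\|\,q)=\mathrm{KL}(\hat p\,\|\,p_{\hat\lambda})+\mathrm{KL}(p_{\hat\lambda}\,\|\,q).$$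
   Context: Let $(\Xi,\mathcal A,\mu)$ be a $\sigma$-finite measure space, $p_0:\Xi\to(0,\infty)$ a probability density with respect to $\mu$, and $T:\Xi\to\mathbb R^k$ measurable. $\mathrm{KL}(p\|q)=\int_\Xi p\log(p/q)\,d\mu\in[0,\infty]$ for probability densities (this is the separable Bregman divergence $D_G$ for $G(t)=t\log t$; $0\log 0=0$). $\mathbb E_p[T]=\int_\Xi pT\,d\mu$. The moment set is $\mathcal M(c)=\{p\text{ probability density w.r.t. }\mu:\ pT\text{ integrable},\ \mathbb E_p[T]=c\}$. The exponential family is $$\mathcal E=\Big\{p_\lambda=\frac{p_0e^{\langle\lambda,T\rangle}}{Z(\lambda)}:\ \lambda\in\mathbb R^k,\ Z(\lambda)=\int_\Xi p_0e^{\langle\lambda,T\rangle}\,d\mu<\infty\Big\},$$ with log-partition function $\log Z$. "Regular" means $\{\lambda:Z(\lambda)<\infty\}$ is open in $\mathbb R^k$. $\mathcal N=\{a\in\mathbb R^k:\langle a,T\rangle=0\ \mu\text{-a.e.}\}$; "minimal modulo $\mathcal N$" means that $\langle a,T\rangle$ is $\mu$-a.e. constant only for $a\in\mathcal N$. The attainable moment set is $\{\mathbb E_p[T]: p\text{ a probability density w.r.t. }\mu,\ pT\text{ integrable}\}\subseteq\mathbb R^k$. Data $x_1,\dots,x_n\in\Xi$ are given, $\hat p=\frac1n\sum_{i=1}^n\delta_{x_i}$ is the empirical distribution, and $\hat c=\mathbb E_{\hat p}[T]=\frac1n\sum_{i=1}^nT(x_i)$. Convention for $\mathrm{KL}(\hat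 p\|q)$: if $\Xi$ is discrete (countable, $\mu$ counting measure) it is the literal KL divergence. In the continuous case, $\mathrm{KL}(\hat p\|q)$ for $q\in\mathcal E$ (evaluated pointwise by the formula for $p_\lambda$) is read as the empirical cross-entropy $-\frac1n\sum_{i=1}^n\log q(x_i)$, both in the minimization defining the m-projection and on both sides of the second identity (the entropy term of $\hat p$, common to both sides, being dropped). *)

theory Defs
  imports "HOL-Probability.Probability"
begin

section \<open>Densities and the Kullback--Leibler divergence\<close>

definition prob_density :: "'a measure \<Rightarrow> ('a \<Rightarrow> real) \<Rightarrow> bool" where
  "prob_density M p \<longleftrightarrow>
     p \<in> borel_measurable M \<and> (\<forall>y\<in>space M. 0 \<le> p y) \<and> (\<integral>\<^sup>+ y. ennreal (p y) \<partial>M) = 1"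

definition kl_integrand :: "real \<Rightarrow> real \<Rightarrow> ereal" where
  "kl_integrand s t = (if s = 0 then 0 else if t = 0 then \<infinity> else ereal (s * ln (s / t)))"

text \<open>
  The library's \<open>KL_divergence\<close> is a Bochner integral, hence real-valued and equal to 0 when the
  integrand is not integrable.  Here the value \<open>\<infinity>\<close> has to be possible, so the integral of
  \<open>p log (p / q)\<close> is taken as the difference of the integrals of its positive and negative part
  (\<open>e2ennreal\<close> truncates at 0).  For probability densities the second integral is at most 1,
  because \<open>s ln (s / t) \<ge> s - t\<close>; so the difference is well defined.  When the integral is
  finite, the definition agrees with \<open>KL_divergence\<close> (lemma \<open>KL_eq_KL_divergence\<close>).
\<close>

definition KL :: "'a measure \<Rightarrow> ('a \<Rightarrow> real) \<Rightarrow> ('a \<Rightarrow> real) \<Rightarrow> ereal" where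
  "KL M p q =
     enn2ereal (\<integral>\<^sup>+ y. e2ennreal (kl_integrand (p y) (q y)) \<partial>M)
     - enn2ereal (\<integral>\<^sup>+ y. e2ennreal (- kl_integrand (p y) (q y)) \<partial>M)"

lemma KL_eq_integral:
  assumes pos: "\<And>y. y \<in> space M \<Longrightarrow> 0 < q y"
    and int: "integrable M (\<lambda>y. p y * ln (p y / q y))"
  shows "KL M p q = ereal (\<integral>y. p y * ln (p y / q y) \<partial>M)"
proof -
  let ?f = "\<lambda>y. p y * ln (p y / q y)"
  have k: "kl_integrand (p y) (q y) = ereal (?f y)" if "y \<in> space M" for y
    using pos[OF that] by (auto simp: kl_integrand_def)
  have 1: "(\<integral>\<^sup>+ y. e2ennreal (kl_integrand (p y) (q y)) \<partial>M) = (\<integral>\<^sup>+ y. ennreal (?f y) \<partial>M)"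
    by (intro nn_integral_cong) (simp add: k ennreal_def)
  have 2: "(\<integral>\<^sup>+ y. e2ennreal (- kl_integrand (p y) (q y)) \<partial>M) = (\<integral>\<^sup>+ y. ennreal (- ?f y) \<partial>M)"
    by (intro nn_integral_cong) (simp add: k ennreal_def)
  obtain a b where "0 \<le> a" "0 \<le> b"
    "(\<integral>\<^sup>+ y. ennreal (?f y) \<partial>M) = ennreal a" "(\<integral>\<^sup>+ y. ennreal (- ?f y) \<partial>M) = ennreal b"
    using int unfolding real_integrable_def
    by (cases "\<integral>\<^sup>+ y. ennreal (?f y) \<partial>M"; cases "\<integral>\<^sup>+ y. ennreal (- ?f y) \<partial>M") auto
  then show ?thesis
    by (simp add: KL_def 1 2 real_lebesgue_integral_def[OF int] enn2ereal_ennreal)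
qed

lemma KL_eq_KL_divergence:
  assumes "sigma_finite_measure M" "prob_density M p" "prob_density M q"
    and pos: "\<And>y. y \<in> space M \<Longrightarrow> 0 < q y"
    and int: "integrable M (\<lambda>y. p y * ln (p y / q y))"
  shows "KL M p q = ereal (KL_divergence (exp 1) (density M q) (density M p))"
proof -
  have "KL_divergence (exp 1) (density M q) (density M p)
      = (\<integral>y. p y * log (exp 1) (p y / q y) \<partial>M)"
    using assms(2,3)
    by (intro sigma_finite_measure.KL_density_density[OF assms(1)])
       (auto simp: prob_density_def intro!: AE_I2 dest: pos)
  then show ?thesis
    using KL_eq_integral[where p = p, OF pos int] by (simp add: log_def)
qed

section \<open>Moments\<close>

definition moment_set :: "'a measure \<Rightarrow> ('a \<Rightarrow> real ^ 'k) \<Rightarrow> real ^ 'k \<Rightarrow> ('a \<Rightarrow> real) set" where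
  "moment_set M T c =
     {p. prob_density M p \<and> integrable M (\<lambda>y. p y *\<^sub>R T y) \<and> (\<integral>y. p y *\<^sub>R T y \<partial>M) = c}"

definition attainable_moments :: "'a measure \<Rightarrow> ('a \<Rightarrow> real ^ 'k) \<Rightarrow> (real ^ 'k) set" where
  "attainable_moments M T =
     {\<integral>y. p y *\<^sub>R T y \<partial>M | p. prob_density M p \<and> integrable M (\<lambda>y. p y *\<^sub>R T y)}"

section \<open>Exponential families\<close>

definition partition_fun ::
    "'a measure \<Rightarrow> ('a \<Rightarrow> real) \<Rightarrow> ('a \<Rightarrow> real ^ 'k) \<Rightarrow> real ^ 'k \<Rightarrow> ennreal" where
  "partition_fun M p0 T l = (\<integral>\<^sup>+ y. ennreal (p0 y * exp (l \<bullet> T y)) \<partial>M)"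

definition natural_parameters ::
    "'a measure \<Rightarrow> ('a \<Rightarrow> real) \<Rightarrow> ('a \<Rightarrow> real ^ 'k) \<Rightarrow> (real ^ 'k) set" where
  "natural_parameters M p0 T = {l. partition_fun M p0 T l < \<infinity>}"

text \<open>The following two are meaningful only for \<open>l \<in> natural_parameters M p0 T\<close>.\<close>

definition log_partition ::
    "'a measure \<Rightarrow> ('a \<Rightarrow> real) \<Rightarrow> ('a \<Rightarrow> real ^ 'k) \<Rightarrow> real ^ 'k \<Rightarrow> real" where
  "log_partition M p0 T l = ln (enn2real (partition_fun M p0 T l))"

definition exp_density ::
    "'a measure \<Rightarrow> ('a \<Rightarrow> real) \<Rightarrow> ('a \<Rightarrow> real ^ 'k) \<Rightarrow> real ^ 'k \<Rightarrow> 'a \<Rightarrow> real" where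
  "exp_density M p0 T l y = p0 y * exp (l \<bullet> T y) / enn2real (partition_fun M p0 T l)"

definition exp_family ::
    "'a measure \<Rightarrow> ('a \<Rightarrow> real) \<Rightarrow> ('a \<Rightarrow> real ^ 'k) \<Rightarrow> ('a \<Rightarrow> real) set" where
  "exp_family M p0 T = exp_density M p0 T ` natural_parameters M p0 T"

definition regular_family :: "'a measure \<Rightarrow> ('a \<Rightarrow> real) \<Rightarrow> ('a \<Rightarrow> real ^ 'k) \<Rightarrow> bool" where
  "regular_family M p0 T \<longleftrightarrow> open (natural_parameters M p0 T)"

definition null_directions :: "'a measure \<Rightarrow> ('a \<Rightarrow> real ^ 'k) \<Rightarrow> (real ^ 'k) set" where
  "null_directions M T = {a. AE y in M. a \<bullet> T y = 0}"

definition minimal_modulo_null :: "'a measure \<Rightarrow> ('a \<Rightarrow> real ^ 'k) \<Rightarrow> bool" where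
  "minimal_modulo_null M T \<longleftrightarrow>
     (\<forall>a. (\<exists>b::real. AE y in M. a \<bullet> T y = b) \<longrightarrow> a \<in> null_directions M T)"

text \<open>
  \<open>l \<bullet> c - log Z(l)\<close> is the dual objective of the maximum-entropy problem with target \<open>c\<close>; for
  \<open>c\<close> the empirical moment it is, up to a constant, the mean log-likelihood.
\<close>

definition optimal_parameter ::
    "'a measure \<Rightarrow> ('a \<Rightarrow> real) \<Rightarrow> ('a \<Rightarrow> real ^ 'k) \<Rightarrow> real ^ 'k \<Rightarrow> real ^ 'k \<Rightarrow> bool" where
  "optimal_parameter M p0 T c l \<longleftrightarrow>
     is_arg_max (\<lambda>l. l \<bullet> c - log_partition M p0 T l) (\<lambda>l. l \<in> natural_parameters M p0 T) l"

section \<open>Empirical distributions\<close>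

definition empirical :: "nat \<Rightarrow> (nat \<Rightarrow> 'a) \<Rightarrow> 'a pmf" where
  "empirical n x = map_pmf x (pmf_of_set {1..n})"

lemma pmf_empirical:
  assumes "1 \<le> n"
  shows "pmf (empirical n x) y = (1 / real n) * (\<Sum>i = 1..n. indicator {x i} y)"
proof -
  have "(\<Sum>i = 1..n. indicator {x i} y) = real (card ({1..n} \<inter> x -` {y}))"
    by (subst card_eq_sum)
       (auto simp: indicator_def sum.inter_restrict intro!: arg_cong[where f = card])
  then show ?thesis
    using assms by (simp add: empirical_def pmf_map measure_pmf_of_set)
qed

lemma expectation_empirical:
  fixes f :: "'a \<Rightarrow> 'b::euclidean_space"
  assumes "1 \<le> n"
  shows "measure_pmf.expectation (empirical n x) f = (1 / real n) *\<^sub>R (\<Sum>i = 1..n. f (x i))"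
  using assms unfolding empirical_def integral_map_pmf
  by (subst integral_measure_pmf[of "{1..n}"]) (auto simp: scaleR_sum_right)

definition discrete_space :: "'a measure \<Rightarrow> bool" where
  "discrete_space M \<longleftrightarrow> countable (space M) \<and> M = count_space (space M)"

text \<open>
  On a discrete space an empirical distribution has a density, its mass function, and the
  divergence from it is the literal one.  Otherwise the cross-entropy is used; it is the
  divergence without the entropy term, and may be negative.
\<close>

definition KL_empirical :: "'a measure \<Rightarrow> 'a pmf \<Rightarrow> ('a \<Rightarrow> real) \<Rightarrow> ereal" where
  "KL_empirical M P q =
     (if discrete_space M then KL M (pmf P) q
      else ereal (- measure_pmf.expectation P (\<lambda>y. ln (q y))))"

section \<open>Projections\<close>

definition is_e_projection ::
    "'a measure \<Rightarrow> ('a \<Rightarrow> real) \<Rightarrow> ('a \<Rightarrow> real) set \<Rightarrow> ('a \<Rightarrow> real) \<Rightarrow> bool" where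
  "is_e_projection M p0 C p \<longleftrightarrow> is_arg_min (\<lambda>p. KL M p p0) (\<lambda>p. p \<in> C) p"

definition is_m_projection ::
    "'a measure \<Rightarrow> 'a pmf \<Rightarrow> ('a \<Rightarrow> real) set \<Rightarrow> ('a \<Rightarrow> real) \<Rightarrow> bool" where
  "is_m_projection M P E q \<longleftrightarrow> is_arg_min (\<lambda>q. KL_empirical M P q) (\<lambda>q. q \<in> E) q"

end

theory Submission
  imports Defs
begin

text \<open>
  Write \<open>c\<close> for the target moment.  If \<open>a \<bullet> (T - c) \<le> 0\<close> almost everywhere, then, \<open>c\<close> being a relative
  interior point of the attainable moments, \<open>a \<bullet> (T - c) = 0\<close> almost everywhere; hence the convex
  function \<open>l \<mapsto> \<integral> p0 exp (l \<bullet> (T - c))\<close> is coercive modulo the directions along which it is constant,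
  and by Fatou's lemma it attains its minimum.  The minimizer is an interior point of the open domain,
  so the derivatives there vanish, which says that the corresponding member \<open>p\<close> of the family has
  moment \<open>c\<close>.  The logarithm of the ratio of two members of the family is affine in \<open>T\<close>, so its
  expectation depends only on the moment.  This gives both Pythagorean identities, and the projections
  and their uniqueness follow from \<open>KL \<ge> 0\<close> with equality only for equal densities.
\<close>

section \<open>The divergence from a positive density\<close>

text \<open>This is \<open>ln x \<le> x - 1\<close> at \<open>x = t / s\<close>. It bounds the
  negative part of the divergence integrand by \<open>t\<close> and, integrated, gives
  nonnegativity.\<close>

lemma le_mult_ln_divide:
  fixes s t :: real
  assumes "0 \<le> s" "0 < t"
  shows "s - t \<le> s * ln (s / t)"
proof (cases "s = 0")
  case False
  then have "0 < s" using assms by simp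
  have "ln (t / s) \<le> t / s - 1"
    using \<open>0 < s\<close> assms by (intro ln_le_minus_one) auto
  then have "s * ln (t / s) \<le> s * (t / s - 1)"
    using \<open>0 < s\<close> by (intro mult_left_mono) auto
  moreover have "ln (t / s) = - ln (s / t)"
    using \<open>0 < s\<close> assms by (simp add: ln_div)
  ultimately show ?thesis using \<open>0 < s\<close> by (simp add: algebra_simps)
qed (use assms in simp)

text \<open>The equality case: \<open>ln x = x - 1\<close> holds only at
  \<open>x = 1\<close>.\<close>

lemma mult_ln_divide_eq_imp_eq:
  fixes s t :: real
  assumes "0 \<le> s" "0 < t" "s * ln (s / t) = s - t"
  shows "s = t"
proof (cases "s = 0")
  case False
  then have "0 < s" using assms by simp
  have "ln (t / s) = - ln (s / t)"
    using \<open>0 < s\<close> assms by (simp add: ln_div)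
  then have "s * ln (t / s) = s * (t / s - 1)"
    using assms \<open>0 < s\<close> by (simp add: algebra_simps)
  then have "ln (t / s) = t / s - 1"
    using \<open>0 < s\<close> by simp
  then have "t / s = 1"
    using \<open>0 < s\<close> assms by (intro ln_eq_minus_one) auto
  then show ?thesis using \<open>0 < s\<close> by simp
qed (use assms in simp)

lemma prob_density_integrable: "prob_density M p \<Longrightarrow> integrable M p"
  by (auto simp: prob_density_def intro!: integrableI_nonneg)

lemma prob_density_integral: "prob_density M p \<Longrightarrow> (\<integral>y. p y \<partial>M) = 1"
  by (subst integral_eq_nn_integral) (auto simp: prob_density_def)

text \<open>Since \<open>s * ln (s / t) \<ge> s - t \<ge> - t\<close>, the negative part integrates
  to at most the mass of \<open>q\<close>, which is 1. Non-integrability can only come from the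
  positive part.\<close>

lemma KL_eq_top:
  assumes p: "prob_density M p" and q: "prob_density M q"
    and pos: "\<And>y. y \<in> space M \<Longrightarrow> 0 < q y"
    and nint: "\<not> integrable M (\<lambda>y. p y * ln (p y / q y))"
  shows "KL M p q = \<infinity>"
proof -
  let ?f = "\<lambda>y. p y * ln (p y / q y)"
  have [measurable]: "p \<in> borel_measurable M" "q \<in> borel_measurable M"
    using p q by (auto simp: prob_density_def)
  have k: "kl_integrand (p y) (q y) = ereal (?f y)" if "y \<in> space M" for y
    using pos[OF that] by (auto simp: kl_integrand_def)
  have 1: "(\<integral>\<^sup>+ y. e2ennreal (kl_integrand (p y) (q y)) \<partial>M) = (\<integral>\<^sup>+ y. ennreal (?f y) \<partial>M)"
    by (intro nn_integral_cong) (simp add: k ennreal_def)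
  have 2: "(\<integral>\<^sup>+ y. e2ennreal (- kl_integrand (p y) (q y)) \<partial>M) = (\<integral>\<^sup>+ y. ennreal (- ?f y) \<partial>M)"
    by (intro nn_integral_cong) (simp add: k ennreal_def)
  have "(\<integral>\<^sup>+ y. ennreal (- ?f y) \<partial>M) \<le> (\<integral>\<^sup>+ y. ennreal (q y) \<partial>M)"
    using p le_mult_ln_divide[of "p _" "q _"] pos
    by (intro nn_integral_mono ennreal_leI) (fastforce simp: prob_density_def)
  then have neg: "(\<integral>\<^sup>+ y. ennreal (- ?f y) \<partial>M) < \<infinity>"
    using q by (auto simp: prob_density_def intro: le_less_trans)
  with nint have "(\<integral>\<^sup>+ y. ennreal (?f y) \<partial>M) = \<infinity>"
    by (auto simp: real_integrable_def)
  then show ?thesis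
    using neg
    by (cases "\<integral>\<^sup>+ y. ennreal (- ?f y) \<partial>M")
       (auto simp: KL_def 1 2 enn2ereal_ennreal)
qed

text \<open>Subtracting \<open>p - q\<close>, which integrates to 0, keeps the integral and makes
  the integrand pointwise nonnegative; a nonnegative function with integral 0 vanishes almost
  everywhere.\<close>

lemma gibbs_AE_eq:
  assumes p: "prob_density M p" and q: "prob_density M q"
    and pos: "\<And>y. y \<in> space M \<Longrightarrow> 0 < q y"
    and int: "integrable M (\<lambda>y. p y * ln (p y / q y))"
  shows "0 \<le> (\<integral>y. p y * ln (p y / q y) \<partial>M)"
    and "(\<integral>y. p y * ln (p y / q y) \<partial>M) = 0 \<Longrightarrow> AE y in M. p y = q y"
proof -
  let ?g = "\<lambda>y. p y * ln (p y / q y) - (p y - q y)"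
  note pq = prob_density_integrable[OF p] prob_density_integrable[OF q]
  have g: "integrable M ?g" using int pq by auto
  have val: "(\<integral>y. ?g y \<partial>M) = (\<integral>y. p y * ln (p y / q y) \<partial>M)"
    using int pq by (simp add: prob_density_integral[OF p] prob_density_integral[OF q])
  have nn: "0 \<le> ?g y" if "y \<in> space M" for y
    using le_mult_ln_divide[of "p y" "q y"] pos[OF that] p that by (auto simp: prob_density_def)
  then show "0 \<le> (\<integral>y. p y * ln (p y / q y) \<partial>M)"
    unfolding val[symmetric] by (intro integral_nonneg_AE) auto
  assume "(\<integral>y. p y * ln (p y / q y) \<partial>M) = 0"
  then have "AE y in M. ?g y = 0"
    using integral_nonneg_eq_0_iff_AE[OF g] nn val by auto
  moreover have "AE y in M. y \<in> space M" by (rule AE_space)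
  ultimately show "AE y in M. p y = q y"
    by eventually_elim (use p pos in \<open>auto simp: prob_density_def intro: mult_ln_divide_eq_imp_eq\<close>)
qed

lemma KL_nonneg:
  assumes "prob_density M p" "prob_density M q" "\<And>y. y \<in> space M \<Longrightarrow> 0 < q y"
  shows "0 \<le> KL M p q"
  by (cases "integrable M (\<lambda>y. p y * ln (p y / q y))")
     (use assms in \<open>simp_all add: KL_eq_top KL_eq_integral gibbs_AE_eq(1)\<close>)

lemma KL_eq_0_imp_AE_eq:
  assumes "prob_density M p" "prob_density M q" "\<And>y. y \<in> space M \<Longrightarrow> 0 < q y" "KL M p q = 0"
  shows "AE y in M. p y = q y"
  by (cases "integrable M (\<lambda>y. p y * ln (p y / q y))")
     (use assms in \<open>simp_all add: KL_eq_top KL_eq_integral gibbs_AE_eq(2)\<close>)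

text \<open>The correction term is finite, so both divergences are finite or infinite together and
  the identity survives the value \<open>\<infinity>\<close>.\<close>

lemma KL_change_reference:
  assumes p: "prob_density M p" and q: "prob_density M q" and q': "prob_density M q'"
    and pos: "\<And>y. y \<in> space M \<Longrightarrow> 0 < q y" "\<And>y. y \<in> space M \<Longrightarrow> 0 < q' y"
    and int: "integrable M (\<lambda>y. p y * ln (q y / q' y))"
  shows "KL M p q' = KL M p q + ereal (\<integral>y. p y * ln (q y / q' y) \<partial>M)"
proof -
  have eq: "p y * ln (p y / q' y) = p y * ln (p y / q y) + p y * ln (q y / q' y)"
    if "y \<in> space M" for y
  proof (cases "p y = 0")
    case False
    then have "0 < p y" using p that by (auto simp: prob_density_def order.strict_iff_order)
    then show ?thesis using pos[OF that] by (simp add: ln_div algebra_simps)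
  qed simp
  show ?thesis
  proof (cases "integrable M (\<lambda>y. p y * ln (p y / q y))")
    case True
    have "integrable M (\<lambda>y. p y * ln (p y / q' y))
        \<longleftrightarrow> integrable M (\<lambda>y. p y * ln (p y / q y) + p y * ln (q y / q' y))"
      by (intro Bochner_Integration.integrable_cong refl eq)
    with True int have int': "integrable M (\<lambda>y. p y * ln (p y / q' y))" by simp
    have "(\<integral>y. p y * ln (p y / q' y) \<partial>M)
        = (\<integral>y. p y * ln (p y / q y) + p y * ln (q y / q' y) \<partial>M)"
      by (intro Bochner_Integration.integral_cong refl eq)
    then show ?thesis
      using True int int' by (simp add: KL_eq_integral pos)
  next
    case False
    have "integrable M (\<lambda>y. p y * ln (p y / q y))
        \<longleftrightarrow> integrable M (\<lambda>y. p y * ln (p y / q' y) - p y * ln (q y / q' y))"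
      by (intro Bochner_Integration.integrable_cong refl) (simp add: eq)
    with False int have "\<not> integrable M (\<lambda>y. p y * ln (p y / q' y))" by auto
    with False show ?thesis by (simp add: KL_eq_top p q q' pos)
  qed
qed

section \<open>Minimizing the partition function\<close>

text \<open>Fatou's lemma, for integrands that converge pointwise.\<close>

lemma partition_fun_lsc:
  fixes T :: "'a \<Rightarrow> real ^ 'k"
  assumes [measurable]: "p0 \<in> borel_measurable M" "T \<in> borel_measurable M"
    and lim: "l \<longlonglongrightarrow> l0"
  shows "partition_fun M p0 T l0 \<le> liminf (\<lambda>j. partition_fun M p0 T (l j))"
proof -
  have "(\<lambda>j. ennreal (p0 y * exp (l j \<bullet> T y))) \<longlonglongrightarrow> ennreal (p0 y * exp (l0 \<bullet> T y))" for y
    by (intro tendsto_intros lim)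
  then have "partition_fun M p0 T l0
      = (\<integral>\<^sup>+ y. liminf (\<lambda>j. ennreal (p0 y * exp (l j \<bullet> T y))) \<partial>M)"
    unfolding partition_fun_def by (intro nn_integral_cong lim_imp_Liminf[symmetric]) simp_all
  also have "\<dots> \<le> liminf (\<lambda>j. partition_fun M p0 T (l j))"
    unfolding partition_fun_def by (intro nn_integral_liminf) measurable
  finally show ?thesis .
qed

text \<open>Where \<open>a0 \<bullet> T y > 0\<close>, the exponents and hence the integrands tend
  to infinity. Fatou's lemma bounds the integral of their liminf by \<open>B\<close>, so such points
  form a null set.\<close>

lemma partition_fun_bounded_direction:
  fixes T :: "'a \<Rightarrow> real ^ 'k"
  assumes [measurable]: "p0 \<in> borel_measurable M" "T \<in> borel_measurable M"
    and pos: "\<And>y. y \<in> space M \<Longrightarrow> 0 < p0 y"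
    and r: "filterlim r at_top sequentially" and a: "a \<longlonglongrightarrow> a0"
    and bound: "\<And>j. partition_fun M p0 T (r j *\<^sub>R a j) \<le> B" and B: "B < \<infinity>"
  shows "AE y in M. a0 \<bullet> T y \<le> 0"
proof -
  let ?f = "\<lambda>j y. ennreal (p0 y * exp ((r j *\<^sub>R a j) \<bullet> T y))"
  have "(\<integral>\<^sup>+ y. liminf (\<lambda>j. ?f j y) \<partial>M) \<le> liminf (\<lambda>j. \<integral>\<^sup>+ y. ?f j y \<partial>M)"
    by (intro nn_integral_liminf) measurable
  also have "\<dots> \<le> B"
    using bound unfolding partition_fun_def by (intro Liminf_le) auto
  finally have "(\<integral>\<^sup>+ y. liminf (\<lambda>j. ?f j y) \<partial>M) \<noteq> \<infinity>"
    using B by (auto simp: top_unique)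
  then have "AE y in M. liminf (\<lambda>j. ?f j y) \<noteq> \<infinity>"
    by (intro nn_integral_PInf_AE) measurable
  moreover have "AE y in M. y \<in> space M" by (rule AE_space)
  ultimately show ?thesis
  proof eventually_elim
    case (elim y)
    show ?case
    proof (rule ccontr)
      assume "\<not> a0 \<bullet> T y \<le> 0"
      moreover have "(\<lambda>j. a j \<bullet> T y) \<longlonglongrightarrow> a0 \<bullet> T y"
        by (intro tendsto_intros a)
      ultimately have "filterlim (\<lambda>j. (a j \<bullet> T y) * r j) at_top sequentially"
        using r by (intro filterlim_tendsto_pos_mult_at_top) auto
      then have "filterlim (\<lambda>j. exp ((r j *\<^sub>R a j) \<bullet> T y)) at_top sequentially"
        by (intro filterlim_compose[OF exp_at_top]) (simp add: mult.commute)
      then have "filterlim (\<lambda>j. p0 y * exp ((r j *\<^sub>R a j) \<bullet> T y)) at_top sequentially"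
        using pos elim by (intro filterlim_tendsto_pos_mult_at_top[OF tendsto_const]) auto
      then have "(\<lambda>j. ?f j y) \<longlonglongrightarrow> \<infinity>"
        by (simp add: ennreal_tendsto_top_eq_at_top)
      then show False
        using elim by (simp add: lim_imp_Liminf)
    qed
  qed
qed

text \<open>
  Along directions \<open>a\<close> with \<open>a \<bullet> T = 0\<close> almost everywhere the partition function is constant.
  On the orthogonal complement of these directions it is coercive, so a minimizing sequence has a
  convergent subsequence there.
\<close>

lemma partition_fun_attains_min:
  fixes T :: "'a \<Rightarrow> real ^ 'k"
  assumes [measurable]: "p0 \<in> borel_measurable M" "T \<in> borel_measurable M"
    and pos: "\<And>y. y \<in> space M \<Longrightarrow> 0 < p0 y"
    and fin: "partition_fun M p0 T 0 < \<infinity>"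
    and two_sided: "\<And>a. AE y in M. a \<bullet> T y \<le> 0 \<Longrightarrow> AE y in M. a \<bullet> T y = 0"
  obtains l where "\<And>l'. partition_fun M p0 T l \<le> partition_fun M p0 T l'"
proof -
  let ?Z = "partition_fun M p0 T"
  define N where "N = {a. AE y in M. a \<bullet> T y = 0}"
  \<comment> \<open>The sublevel condition keeps all candidates for the minimum; orthogonality to
    \<open>N\<close> removes the directions in which boundedness would fail.\<close>
  define S where "S = {l. (\<forall>a\<in>N. orthogonal l a) \<and> ?Z l \<le> ?Z 0}"
  have "subspace N"
    by (auto simp: N_def subspace_def inner_add_left elim: eventually_elim2)
  have "0 \<in> S" by (simp add: S_def orthogonal_def)
  have "bounded S"
  proof (rule ccontr)
    assume "\<not> bounded S"
    then have "\<exists>l\<in>S. real j < norm l" for j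
      by (metis bounded_iff not_le)
    then obtain l where l: "\<And>j. l j \<in> S" "\<And>j. real j < norm (l j)"
      by metis
    \<comment> \<open>Compactness of the unit sphere yields a limiting direction \<open>a0\<close>
      of the unbounded sequence.\<close>
    define a where "a j = l j /\<^sub>R norm (l j)" for j
    have nz: "l j \<noteq> 0" for j using l(2)[of j] by auto
    have "\<forall>j. a j \<in> sphere 0 1" using nz by (simp add: a_def)
    then obtain a0 s where a0: "a0 \<in> sphere 0 1" "strict_mono s" "(a \<circ> s) \<longlonglongrightarrow> a0"
      using compact_sphere unfolding compact_def by metis
    have r: "filterlim (\<lambda>j. norm (l (s j))) at_top sequentially"
    proof (rule filterlim_at_top_mono)
      show "filterlim real at_top sequentially" by (rule filterlim_real_sequentially)
      show "\<forall>\<^sub>F j in sequentially. real j \<le> norm (l (s j))"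
        using l(2) seq_suble[OF a0(2)]
        by (intro always_eventually) (metis less_imp_le of_nat_le_iff order_trans)
    qed
    have "norm (l (s j)) *\<^sub>R (a \<circ> s) j = l (s j)" for j
      using nz by (simp add: a_def)
    then have "?Z (norm (l (s j)) *\<^sub>R (a \<circ> s) j) \<le> ?Z 0" for j
      using l(1)[of "s j"] by (simp add: S_def)
    then have "AE y in M. a0 \<bullet> T y \<le> 0"
      using fin by (intro partition_fun_bounded_direction[OF assms(1,2) pos r a0(3)])
    \<comment> \<open>Now \<open>a0\<close> lies in \<open>N\<close> while each
      \<open>a (s j)\<close> is orthogonal to \<open>N\<close>; in the limit \<open>a0\<close> is
      orthogonal to itself, although it has norm 1.\<close>
    then have "a0 \<in> N" using two_sided by (simp add: N_def)
    then have "(a \<circ> s) j \<bullet> a0 = 0" for j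
      using l(1)[of "s j"] by (simp add: S_def a_def orthogonal_def)
    moreover have "(\<lambda>j. (a \<circ> s) j \<bullet> a0) \<longlonglongrightarrow> a0 \<bullet> a0"
      by (intro tendsto_intros a0(3))
    ultimately have "a0 \<bullet> a0 = 0" by (simp add: LIMSEQ_const_iff)
    with a0(1) show False by simp
  qed
  obtain u where u: "\<And>j. u j \<in> ?Z ` S" "u \<longlonglongrightarrow> Inf (?Z ` S)"
    using Inf_as_limit[of "?Z ` S"] \<open>0 \<in> S\<close> by blast
  then obtain l where l: "\<And>j. l j \<in> S" "\<And>j. u j = ?Z (l j)"
    unfolding image_iff by metis
  have "bounded (range l)" by (rule bounded_subset[OF \<open>bounded S\<close>]) (use l in auto)
  then obtain l0 s where l0: "strict_mono s" "(l \<circ> s) \<longlonglongrightarrow> l0"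
    using bounded_imp_convergent_subsequence by blast
  have "(u \<circ> s) \<longlonglongrightarrow> Inf (?Z ` S)" by (rule LIMSEQ_subseq_LIMSEQ[OF u(2) l0(1)])
  moreover have "u \<circ> s = (\<lambda>j. ?Z ((l \<circ> s) j))" by (auto simp: l(2))
  ultimately have "liminf (\<lambda>j. ?Z ((l \<circ> s) j)) = Inf (?Z ` S)"
    by (simp add: lim_imp_Liminf)
  then have min: "?Z l0 \<le> Inf (?Z ` S)"
    using partition_fun_lsc[OF assms(1,2) l0(2)] by simp
  show ?thesis
  proof
    fix l'
    \<comment> \<open>Only the component \<open>z\<close> orthogonal to \<open>N\<close> affects
      \<open>?Z\<close>. It lies in \<open>S\<close> unless its value exceeds \<open>?Z 0\<close>,
      and then \<open>0 \<in> S\<close> already does better.\<close>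
    obtain y z where yz: "y \<in> span N" "\<And>w. w \<in> span N \<Longrightarrow> orthogonal z w" "l' = y + z"
      using orthogonal_subspace_decomp_exists[of N l'] by blast
    have "y \<in> N" using yz(1) \<open>subspace N\<close> by (simp add: span_eq_iff[THEN iffD2])
    then have eq: "?Z l' = ?Z z"
      unfolding partition_fun_def yz(3)
      by (intro nn_integral_cong_AE) (auto simp: N_def inner_add_left elim: eventually_mono)
    show "?Z l0 \<le> ?Z l'"
    proof (cases "?Z z \<le> ?Z 0")
      case True
      then have "z \<in> S" using yz(2) by (auto simp: S_def intro: span_base)
      then have "Inf (?Z ` S) \<le> ?Z z" by (intro Inf_lower) auto
      with min eq show ?thesis by simp
    next
      case False
      have "Inf (?Z ` S) \<le> ?Z 0" using \<open>0 \<in> S\<close> by (intro Inf_lower) auto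
      with min eq False show ?thesis by simp
    qed
  qed
qed

section \<open>Stationarity of the minimizer\<close>

text \<open>The lower bound is \<open>1 + x \<le> exp x\<close>; the upper one is convexity of
  \<open>exp\<close> between \<open>0\<close> and \<open>e * u\<close> with weight
  \<open>t / e\<close>. Neither bound depends on \<open>t\<close>, as dominated convergence
  requires.\<close>

lemma exp_diff_quotient_bounds:
  fixes t e u :: real
  assumes "0 < t" "t \<le> e"
  shows "u \<le> (exp (t * u) - 1) / t" and "(exp (t * u) - 1) / t \<le> exp (e * u) / e"
proof -
  have "1 + t * u \<le> exp (t * u)" by (rule exp_ge_add_one_self)
  then show "u \<le> (exp (t * u) - 1) / t" using assms by (simp add: field_simps)
  have "exp ((1 - t / e) *\<^sub>R 0 + (t / e) *\<^sub>R (e * u)) \<le> (1 - t / e) * exp 0 + t / e * exp (e * u)"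
    using assms by (intro convex_onD[OF exp_convex]) auto
  also have "\<dots> \<le> 1 + t / e * exp (e * u)" using assms by simp
  finally have "exp (t * u) - 1 \<le> t / e * exp (e * u)" using assms by simp
  then show "(exp (t * u) - 1) / t \<le> exp (e * u) / e" using assms by (simp add: field_simps)
qed

text \<open>The integral of \<open>w y * u y\<close> is the right derivative at 0 of the integral of
  \<open>w y * exp (t * u y)\<close>, a limit of difference quotients that minimality makes
  nonnegative.\<close>

lemma integral_exp_right_derivative:
  fixes w u :: "'a \<Rightarrow> real"
  assumes [measurable]: "w \<in> borel_measurable M" "u \<in> borel_measurable M"
    and w: "\<And>y. y \<in> space M \<Longrightarrow> 0 \<le> w y"
    and e: "0 < e"
    and int: "\<And>t. \<bar>t\<bar> \<le> e \<Longrightarrow> integrable M (\<lambda>y. w y * exp (t * u y))"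
    and min: "\<And>t. \<lbrakk>0 < t; t \<le> e\<rbrakk> \<Longrightarrow> (\<integral>y. w y \<partial>M) \<le> (\<integral>y. w y * exp (t * u y) \<partial>M)"
  shows "integrable M (\<lambda>y. w y * u y)" and "0 \<le> (\<integral>y. w y * u y \<partial>M)"
proof -
  \<comment> \<open>A common bound for all difference quotients. The second summand controls them
    from below, through \<open>x \<le> exp x\<close> at \<open>x = - e * u y\<close>; this is where
    integrability at negative \<open>t\<close> enters.\<close>
  define h where "h y = w y * exp (e * u y) / e + w y * exp (- e * u y) / e" for y
  define t where "t j = e / real (Suc j)" for j
  have t: "0 < t j" "t j \<le> e" for j using e by (auto simp: t_def field_simps)
  let ?s = "\<lambda>j y. w y * ((exp (t j * u y) - 1) / t j)"
  have h: "integrable M h" unfolding h_def using int[of e] int[of "- e"] e by auto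
  have "(\<lambda>j. t j) \<longlonglongrightarrow> 0" unfolding t_def by real_asymp
  then have t0: "filterlim t (at 0) sequentially"
    using t by (auto simp: filterlim_at intro!: always_eventually) (metis less_irrefl)
  have lim: "(\<lambda>j. ?s j y) \<longlonglongrightarrow> w y * u y" for y
  proof -
    have "((\<lambda>t. exp (t * u y)) has_real_derivative u y) (at 0)"
      by (auto intro!: derivative_eq_intros)
    then have "((\<lambda>t. (exp (t * u y) - 1) / t) \<longlongrightarrow> u y) (at 0)"
      by (simp add: has_field_derivative_iff)
    from filterlim_compose[OF this t0] show ?thesis by (intro tendsto_intros)
  qed
  have bound: "norm (?s j y) \<le> h y" if "y \<in> space M" for j y
  proof -
    have "- e * u y \<le> exp (- e * u y)" using exp_ge_add_one_self[of "- e * u y"] by linarith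
    then have "- u y \<le> exp (- e * u y) / e" using e by (simp add: field_simps)
    then have lower: "- (exp (- e * u y) / e) \<le> (exp (t j * u y) - 1) / t j"
      using exp_diff_quotient_bounds(1)[OF t(1)[of j] t(2)[of j], of "u y"] by linarith
    note upper = exp_diff_quotient_bounds(2)[OF t(1)[of j] t(2)[of j], of "u y"]
    have "0 \<le> exp (e * u y) / e" "0 \<le> exp (- e * u y) / e" using e by auto
    with lower upper have "\<bar>(exp (t j * u y) - 1) / t j\<bar> \<le> exp (e * u y) / e + exp (- e * u y) / e"
      by linarith
    then have "w y * \<bar>(exp (t j * u y) - 1) / t j\<bar> \<le> w y * (exp (e * u y) / e + exp (- e * u y) / e)"
      using w[OF that] by (intro mult_left_mono)
    also have "w y * \<bar>(exp (t j * u y) - 1) / t j\<bar> = norm (?s j y)"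
      by (simp only: real_norm_def abs_mult abs_of_nonneg[OF w[OF that]])
    finally show ?thesis by (simp add: h_def ring_distribs)
  qed
  have dct: "integrable M (\<lambda>y. w y * u y)" "(\<lambda>j. \<integral>y. ?s j y \<partial>M) \<longlonglongrightarrow> (\<integral>y. w y * u y \<partial>M)"
  proof -
    have ae: "AE y in M. (\<lambda>j. ?s j y) \<longlonglongrightarrow> w y * u y" "\<And>j. AE y in M. norm (?s j y) \<le> h y"
      using lim bound by (auto intro!: AE_I2 simp del: real_norm_def)
    show "integrable M (\<lambda>y. w y * u y)"
      by (rule integrable_dominated_convergence[OF _ _ h ae]) measurable
    show "(\<lambda>j. \<integral>y. ?s j y \<partial>M) \<longlonglongrightarrow> (\<integral>y. w y * u y \<partial>M)"
      by (rule integral_dominated_convergence[OF _ _ h ae]) measurable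
  qed
  show "integrable M (\<lambda>y. w y * u y)" by (rule dct(1))
  have "0 \<le> (\<integral>y. ?s j y \<partial>M)" for j
  proof -
    have "integrable M w" using int[of 0] e by simp
    moreover have "integrable M (\<lambda>y. w y * exp (t j * u y))"
      using int[of "t j"] t[of j] by simp
    moreover have "(\<lambda>y. ?s j y) = (\<lambda>y. (w y * exp (t j * u y) - w y) / t j)"
      by (auto simp: field_simps)
    ultimately show ?thesis using min[OF t[of j]] t[of j] by simp
  qed
  then show "0 \<le> (\<integral>y. w y * u y \<partial>M)"
    by (intro LIMSEQ_le_const[OF dct(2)]) auto
qed

lemma integrable_vec_inner:
  fixes f :: "'a \<Rightarrow> real ^ 'k"
  assumes "f \<in> borel_measurable M" "\<And>a. integrable M (\<lambda>y. a \<bullet> f y)"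
  shows "integrable M f"
proof -
  have "integrable M (\<lambda>y. \<Sum>b\<in>Basis. (b \<bullet> f y) *\<^sub>R b)"
    using assms(2) by (intro Bochner_Integration.integrable_sum integrable_scaleR_left)
  then show ?thesis by (simp add: euclidean_representation inner_commute[of _ "f _"])
qed

section \<open>Exponential families and their moments\<close>

locale exponential_family =
  fixes M :: "'a measure" and p0 :: "'a \<Rightarrow> real" and T :: "'a \<Rightarrow> real ^ 'k"
  assumes p0: "prob_density M p0"
    and p0_pos: "\<And>y. y \<in> space M \<Longrightarrow> 0 < p0 y"
    and T_measurable [measurable]: "T \<in> borel_measurable M"
begin

abbreviation "P \<equiv> exp_density M p0 T"
abbreviation "\<Lambda> \<equiv> natural_parameters M p0 T"

lemma p0_measurable [measurable]: "p0 \<in> borel_measurable M"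
  using p0 by (simp add: prob_density_def)

text \<open>The total mass 1 of \<open>p0\<close> excludes the zero measure.\<close>

lemma not_AE_False: "\<not> (AE y in M. False)"
proof
  assume "AE y in M. False"
  then have "(\<integral>\<^sup>+ y. ennreal (p0 y) \<partial>M) = (\<integral>\<^sup>+ y. 0 \<partial>M)"
    by (intro nn_integral_cong_AE) auto
  then show False using p0 by (simp add: prob_density_def)
qed

lemma nn_integral_pos:
  assumes [measurable]: "f \<in> borel_measurable M" and "\<And>y. y \<in> space M \<Longrightarrow> 0 < f y"
  shows "0 < (\<integral>\<^sup>+ y. ennreal (f y) \<partial>M)"
proof (rule ccontr)
  assume "\<not> 0 < (\<integral>\<^sup>+ y. ennreal (f y) \<partial>M)"
  then have "AE y in M. ennreal (f y) = 0"
    by (simp add: nn_integral_0_iff_AE)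
  moreover have "AE y in M. y \<in> space M" by (rule AE_space)
  ultimately have "AE y in M. False"
    by eventually_elim (use assms(2) in \<open>force simp: ennreal_eq_0_iff\<close>)
  with not_AE_False show False ..
qed

lemma partition_pos:
  assumes "l \<in> \<Lambda>" shows "0 < enn2real (partition_fun M p0 T l)"
  using assms nn_integral_pos[of "\<lambda>y. p0 y * exp (l \<bullet> T y)"] p0_pos
  by (simp add: natural_parameters_def partition_fun_def enn2real_positive_iff)

lemma exp_density_pos: "\<lbrakk>l \<in> \<Lambda>; y \<in> space M\<rbrakk> \<Longrightarrow> 0 < P l y"
  using p0_pos partition_pos by (simp add: exp_density_def)

lemma prob_density_exp_density:
  assumes l: "l \<in> \<Lambda>" shows "prob_density M (P l)"
proof -
  let ?z = "enn2real (partition_fun M p0 T l)"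
  have z: "ennreal ?z = partition_fun M p0 T l"
    using l by (simp add: natural_parameters_def ennreal_enn2real)
  have "(\<integral>\<^sup>+ y. ennreal (P l y) \<partial>M) = (\<integral>\<^sup>+ y. ennreal (inverse ?z) * ennreal (p0 y * exp (l \<bullet> T y)) \<partial>M)"
    using p0_pos by (intro nn_integral_cong)
      (simp add: exp_density_def ennreal_mult'[symmetric] divide_inverse mult.commute)
  also have "\<dots> = ennreal (inverse ?z) * ennreal ?z"
    unfolding z by (subst nn_integral_cmult) (auto simp: partition_fun_def)
  also have "\<dots> = 1"
    using partition_pos[OF l] by (simp add: ennreal_mult'[symmetric])
  finally have "(\<integral>\<^sup>+ y. ennreal (P l y) \<partial>M) = 1" .
  moreover have "P l \<in> borel_measurable M" unfolding exp_density_def by measurable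
  ultimately show ?thesis
    using exp_density_pos[OF l] by (auto simp: prob_density_def intro: less_imp_le)
qed

lemma partition_fun_0: "partition_fun M p0 T 0 = 1"
  using p0 by (simp add: partition_fun_def prob_density_def)

lemma zero_natural: "0 \<in> \<Lambda>"
  by (simp add: natural_parameters_def partition_fun_0)

text \<open>The base point is the member with parameter 0, so facts about pairs of members also
  cover divergences from \<open>p0\<close>.\<close>

lemma exp_density_0: "P 0 = p0"
  by (auto simp: exp_density_def partition_fun_0)

section \<open>Log-ratios of members and the Pythagorean identity\<close>

lemma ln_exp_density:
  assumes "l \<in> \<Lambda>" "y \<in> space M"
  shows "ln (P l y) = ln (p0 y) + l \<bullet> T y - log_partition M p0 T l"
  using p0_pos[OF assms(2)] partition_pos[OF assms(1)]
  by (simp add: exp_density_def log_partition_def ln_div ln_mult)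

lemma ln_exp_density_ratio:
  assumes "l \<in> \<Lambda>" "l' \<in> \<Lambda>" "y \<in> space M"
  shows "ln (P l y / P l' y)
    = (l - l') \<bullet> T y - (log_partition M p0 T l - log_partition M p0 T l')"
  using exp_density_pos assms
  by (simp add: ln_div less_imp_neq[symmetric] ln_exp_density inner_diff_left)

text \<open>The log-ratio is affine in \<open>T\<close>, so its integral against \<open>r\<close>
  sees only the total mass 1 and the moment \<open>c\<close>.\<close>

lemma moment_ln_ratio:
  assumes l: "l \<in> \<Lambda>" "l' \<in> \<Lambda>" and r: "r \<in> moment_set M T c"
  shows "integrable M (\<lambda>y. r y * ln (P l y / P l' y))"
    and "(\<integral>y. r y * ln (P l y / P l' y) \<partial>M)
      = (l - l') \<bullet> c - (log_partition M p0 T l - log_partition M p0 T l')"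
proof -
  let ?k = "log_partition M p0 T l - log_partition M p0 T l'"
  let ?g = "\<lambda>y. (l - l') \<bullet> (r y *\<^sub>R T y) - ?k * r y"
  have r': "prob_density M r" "integrable M (\<lambda>y. r y *\<^sub>R T y)" "(\<integral>y. r y *\<^sub>R T y \<partial>M) = c"
    using r by (auto simp: moment_set_def)
  have eq: "r y * ln (P l y / P l' y) = ?g y" if "y \<in> space M" for y
    using that by (simp add: ln_exp_density_ratio[OF l] algebra_simps)
  have 1: "integrable M (\<lambda>y. (l - l') \<bullet> (r y *\<^sub>R T y))"
    by (rule integrable_inner_right) (use r'(2) in simp)
  have 2: "(\<integral>y. (l - l') \<bullet> (r y *\<^sub>R T y) \<partial>M) = (l - l') \<bullet> c"
    unfolding r'(3)[symmetric] by (rule integral_inner_right) (use r'(2) in simp)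
  have "integrable M ?g"
    using 1 prob_density_integrable[OF r'(1)] by (intro Bochner_Integration.integrable_diff integrable_mult_right) auto
  then show "integrable M (\<lambda>y. r y * ln (P l y / P l' y))"
    by (subst Bochner_Integration.integrable_cong[OF refl eq])
  have "(\<integral>y. r y * ln (P l y / P l' y) \<partial>M) = (\<integral>y. ?g y \<partial>M)"
    by (intro Bochner_Integration.integral_cong refl eq)
  also have "\<dots> = (\<integral>y. (l - l') \<bullet> (r y *\<^sub>R T y) \<partial>M) - (\<integral>y. ?k * r y \<partial>M)"
    using 1 prob_density_integrable[OF r'(1)]
    by (intro Bochner_Integration.integral_diff integrable_mult_right) auto
  also have "\<dots> = (l - l') \<bullet> c - ?k"
    by (simp only: 2 integral_mult_right_zero prob_density_integral[OF r'(1)] mult_1_right)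
  finally show "(\<integral>y. r y * ln (P l y / P l' y) \<partial>M) = (l - l') \<bullet> c - ?k" .
qed

lemma KL_exp_density:
  assumes l: "l \<in> \<Lambda>" "l' \<in> \<Lambda>" and "P l \<in> moment_set M T c"
  shows "KL M (P l) (P l')
    = ereal ((l - l') \<bullet> c - (log_partition M p0 T l - log_partition M p0 T l'))"
  using KL_eq_integral[OF exp_density_pos[OF l(2)] moment_ln_ratio(1)[OF assms]]
  by (simp add: moment_ln_ratio(2)[OF assms])

text \<open>\<open>KL_change_reference\<close> leaves the expectation of the log-ratio under
  \<open>r\<close>. As \<open>P l\<close> has the same moment, this equals the expectation under
  \<open>P l\<close>, which is \<open>KL M (P l) (P l')\<close>.\<close>

lemma KL_pythagoras:
  assumes l: "l \<in> \<Lambda>" "l' \<in> \<Lambda>" and "P l \<in> moment_set M T c" and r: "r \<in> moment_set M T c"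
  shows "KL M r (P l') = KL M r (P l) + KL M (P l) (P l')"
proof -
  have "prob_density M r" using r by (simp add: moment_set_def)
  then show ?thesis
    unfolding KL_exp_density[OF assms(1-3)] moment_ln_ratio(2)[OF l r, symmetric]
    by (intro KL_change_reference moment_ln_ratio(1)[OF l r] prob_density_exp_density exp_density_pos l)
qed

section \<open>The two sides of a hyperplane through a relative interior moment\<close>

lemma moment_halfspace:
  assumes p: "prob_density M p" and int: "integrable M (\<lambda>y. p y *\<^sub>R T y)"
    and half: "AE y in M. a \<bullet> (T y - c) \<le> 0"
  shows "integrable M (\<lambda>y. p y * (a \<bullet> (T y - c)))"
    and "a \<bullet> ((\<integral>y. p y *\<^sub>R T y \<partial>M) - c) = (\<integral>y. p y * (a \<bullet> (T y - c)) \<partial>M)"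
    and "(\<integral>y. p y * (a \<bullet> (T y - c)) \<partial>M) \<le> 0"
proof -
  have eq: "p y * (a \<bullet> (T y - c)) = a \<bullet> (p y *\<^sub>R T y) - (a \<bullet> c) * p y" for y
    by (simp add: algebra_simps)
  have 1: "integrable M (\<lambda>y. a \<bullet> (p y *\<^sub>R T y))"
    by (rule integrable_inner_right) (use int in simp)
  have 2: "(\<integral>y. a \<bullet> (p y *\<^sub>R T y) \<partial>M) = a \<bullet> (\<integral>y. p y *\<^sub>R T y \<partial>M)"
    by (rule integral_inner_right) (use int in simp)
  have 3: "integrable M (\<lambda>y. (a \<bullet> c) * p y)"
    using prob_density_integrable[OF p] by simp
  show "integrable M (\<lambda>y. p y * (a \<bullet> (T y - c)))"
    unfolding eq using 1 3 by (rule Bochner_Integration.integrable_diff)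
  show "a \<bullet> ((\<integral>y. p y *\<^sub>R T y \<partial>M) - c) = (\<integral>y. p y * (a \<bullet> (T y - c)) \<partial>M)"
    unfolding eq Bochner_Integration.integral_diff[OF 1 3] 2
    by (simp add: prob_density_integral[OF p] inner_diff_right)
  have "AE y in M. y \<in> space M" by (rule AE_space)
  with half have "AE y in M. 0 \<le> - (p y * (a \<bullet> (T y - c)))"
    by eventually_elim (use p in \<open>auto simp: prob_density_def mult_le_0_iff\<close>)
  then have "0 \<le> (\<integral>y. - (p y * (a \<bullet> (T y - c))) \<partial>M)" by (rule integral_nonneg_AE)
  then show "(\<integral>y. p y * (a \<bullet> (T y - c)) \<partial>M) \<le> 0" by simp
qed

text \<open>\<open>p0\<close> itself may lack a first moment. Damping it by
  \<open>1 + norm (T y)\<close> keeps it positive and makes both \<open>w\<close> and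
  \<open>w y * norm (T y)\<close> bounded by \<open>p0\<close>; then normalize.\<close>

lemma positive_density_with_moment:
  obtains r where "prob_density M r" "\<And>y. y \<in> space M \<Longrightarrow> 0 < r y"
    "integrable M (\<lambda>y. r y *\<^sub>R T y)"
proof -
  define w where "w y = p0 y / (1 + norm (T y))" for y
  have [measurable]: "w \<in> borel_measurable M" unfolding w_def by measurable
  have w_pos: "0 < w y" if "y \<in> space M" for y
    using p0_pos[OF that] by (simp add: w_def add_pos_nonneg)
  have w_le: "w y \<le> p0 y" "w y * norm (T y) \<le> p0 y" if "y \<in> space M" for y
  proof -
    have *: "0 < 1 + norm (T y)" by (simp add: add_pos_nonneg)
    show "w y \<le> p0 y" "w y * norm (T y) \<le> p0 y"
      unfolding w_def using p0_pos[OF that] *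
      by (simp_all add: pos_divide_le_eq mult_le_cancel_left1 distrib_left)
  qed
  have w: "integrable M w"
  proof (rule Bochner_Integration.integrable_bound[OF prob_density_integrable[OF p0]])
    show "AE y in M. norm (w y) \<le> norm (p0 y)"
      using w_le(1) w_pos p0_pos by (intro AE_I2) (simp add: abs_of_pos)
  qed measurable
  have wT: "integrable M (\<lambda>y. w y *\<^sub>R T y)"
  proof (rule Bochner_Integration.integrable_bound[OF prob_density_integrable[OF p0]])
    show "AE y in M. norm (w y *\<^sub>R T y) \<le> norm (p0 y)"
      using w_le(2) w_pos p0_pos by (intro AE_I2) (simp add: abs_of_pos)
  qed measurable
  define z where "z = (\<integral>y. w y \<partial>M)"
  have nn: "(\<integral>\<^sup>+ y. ennreal (w y) \<partial>M) = ennreal z"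
    unfolding z_def using w w_pos by (intro nn_integral_eq_integral) (auto intro!: AE_I2 less_imp_le)
  have z: "0 < z"
    using nn_integral_pos[of w] w_pos by (simp add: nn)
  show ?thesis
  proof
    have "(\<integral>\<^sup>+ y. ennreal (w y / z) \<partial>M) = (\<integral>\<^sup>+ y. ennreal (inverse z) * ennreal (w y) \<partial>M)"
      using w_pos z by (intro nn_integral_cong) (simp add: ennreal_mult'[symmetric] divide_inverse mult.commute)
    also have "\<dots> = 1"
      using z by (subst nn_integral_cmult) (auto simp: nn ennreal_mult'[symmetric])
    finally show "prob_density M (\<lambda>y. w y / z)"
      using z w_pos by (auto simp: prob_density_def intro!: divide_nonneg_pos less_imp_le)
    show "0 < w y / z" if "y \<in> space M" for y using w_pos[OF that] z by simp
    have "integrable M (\<lambda>y. inverse z *\<^sub>R (w y *\<^sub>R T y))"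
      using wT by (intro integrable_scaleR_right) auto
    then show "integrable M (\<lambda>y. (w y / z) *\<^sub>R T y)"
      by (simp add: divide_inverse mult.commute)
  qed
qed

text \<open>
  The moment \<open>m\<close> of a strictly positive density lies in the closed half-space.  So does an attainable
  point slightly beyond \<open>c\<close> on the line from \<open>m\<close> through \<open>c\<close>, which forces \<open>m\<close> onto the hyperplane.
\<close>

lemma rel_interior_moment_two_sided:
  assumes c: "c \<in> rel_interior (attainable_moments M T)"
    and half: "AE y in M. a \<bullet> (T y - c) \<le> 0"
  shows "AE y in M. a \<bullet> (T y - c) = 0"
proof -
  let ?A = "attainable_moments M T"
  obtain r where r: "prob_density M r" "\<And>y. y \<in> space M \<Longrightarrow> 0 < r y"
      "integrable M (\<lambda>y. r y *\<^sub>R T y)"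
    by (rule positive_density_with_moment) blast
  define m where "m = (\<integral>y. r y *\<^sub>R T y \<partial>M)"
  have m: "m \<in> ?A" using r by (auto simp: m_def attainable_moments_def)
  note hr = moment_halfspace[OF r(1,3) half]
  obtain e where e: "0 < e" "ball c e \<inter> affine hull ?A \<subseteq> ?A" and "c \<in> ?A"
    using c by (auto simp: mem_rel_interior_ball)
  \<comment> \<open>Chosen so that \<open>d * norm (m - c) \<le> e / 2\<close>; the added 1 covers
    the case \<open>m = c\<close>.\<close>
  define d where "d = e / (2 * (norm (m - c) + 1))"
  have d: "0 < d" unfolding d_def using e by (simp add: add_nonneg_pos)
  define c' where "c' = (1 + d) *\<^sub>R c + (- d) *\<^sub>R m"
  have "c' \<in> affine hull ?A"
    unfolding c'_def using m \<open>c \<in> ?A\<close>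
    by (intro mem_affine[OF affine_affine_hull]) (auto intro: hull_inc)
  moreover have "c' \<in> ball c e"
  proof -
    have "c - c' = d *\<^sub>R (m - c)" by (simp add: c'_def algebra_simps)
    then have "dist c c' = d * norm (m - c)" using d by (simp add: dist_norm)
    also have "\<dots> = (e / 2) * (norm (m - c) / (norm (m - c) + 1))"
      by (simp add: d_def)
    also have "\<dots> \<le> (e / 2) * 1"
      using e by (intro mult_left_mono) (auto simp: divide_le_eq_1 add_nonneg_pos)
    also have "\<dots> < e" using e by simp
    finally show ?thesis by simp
  qed
  ultimately have "c' \<in> ?A" using e by blast
  then obtain p where p: "prob_density M p" "integrable M (\<lambda>y. p y *\<^sub>R T y)"
      "c' = (\<integral>y. p y *\<^sub>R T y \<partial>M)"
    by (auto simp: attainable_moments_def)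
  have "a \<bullet> (c' - c) \<le> 0" using moment_halfspace[OF p(1,2) half] by (simp add: p(3))
  \<comment> \<open>Since \<open>c' - c = - d *\<^sub>R (m - c)\<close>, the half-space condition at
    \<open>c'\<close> becomes the opposite inequality at \<open>m\<close>.\<close>
  then have "d * (a \<bullet> (m - c)) \<ge> 0" by (simp add: c'_def algebra_simps)
  then have "a \<bullet> (m - c) \<ge> 0" using d by (simp add: zero_le_mult_iff)
  then have "(\<integral>y. r y * (a \<bullet> (T y - c)) \<partial>M) = 0" using hr(2,3) by (simp add: m_def)
  then have "(\<integral>y. - (r y * (a \<bullet> (T y - c))) \<partial>M) = 0" by simp
  moreover have sp: "AE y in M. y \<in> space M" by (rule AE_space)
  moreover have "AE y in M. 0 \<le> - (r y * (a \<bullet> (T y - c)))"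
    using half sp by eventually_elim (use r(2) in \<open>auto simp: mult_le_0_iff less_imp_le\<close>)
  ultimately have "AE y in M. - (r y * (a \<bullet> (T y - c))) = 0"
    using integral_nonneg_eq_0_iff_AE[of M "\<lambda>y. - (r y * (a \<bullet> (T y - c)))"] hr(1) by simp
  \<comment> \<open>Strict positivity of \<open>r\<close> lets it be cancelled from the vanishing
    product.\<close>
  with sp show ?thesis
    by eventually_elim (use r(2) in force)
qed

section \<open>Existence of a member of the family with prescribed moment\<close>

text \<open>Minimizing the centred partition function is thus maximizing the dual objective
  \<open>l \<bullet> c - log Z(l)\<close>, and the moment condition becomes a vanishing
  gradient.\<close>

lemma partition_fun_shift:
  "partition_fun M p0 (\<lambda>y. T y - c) l = ennreal (exp (- (l \<bullet> c))) * partition_fun M p0 T l"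
proof -
  have "ennreal (p0 y * exp (l \<bullet> (T y - c)))
      = ennreal (exp (- (l \<bullet> c))) * ennreal (p0 y * exp (l \<bullet> T y))" for y
    by (subst ennreal_mult'[symmetric]) (auto simp: inner_diff_right exp_diff exp_minus field_simps)
  then show ?thesis
    unfolding partition_fun_def by (subst nn_integral_cmult[symmetric]) auto
qed

lemma shifted_partition_fun_finite_iff:
  "partition_fun M p0 (\<lambda>y. T y - c) l < \<infinity> \<longleftrightarrow> l \<in> \<Lambda>"
proof -
  have "ennreal (exp (- (l \<bullet> c))) \<noteq> 0" by (simp add: ennreal_eq_0_iff not_le)
  then show ?thesis
    unfolding partition_fun_shift natural_parameters_def mem_Collect_eq infinity_ennreal_def
      ennreal_mult_less_top by (auto simp: top.not_eq_extremum)
qed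

lemma ex_exp_density_moment:
  assumes reg: "regular_family M p0 T"
    and c: "c \<in> rel_interior (attainable_moments M T)"
  obtains l where "l \<in> \<Lambda>" "P l \<in> moment_set M T c"
proof -
  let ?U = "\<lambda>y. T y - c"
  let ?Z = "partition_fun M p0 ?U"
  have "?Z 0 < \<infinity>" using shifted_partition_fun_finite_iff zero_natural by simp
  \<comment> \<open>With \<open>T\<close> centred at \<open>c\<close>, the two-sidedness needed for
    coercivity is the relative interior property.\<close>
  obtain l where min: "\<And>l'. ?Z l \<le> ?Z l'"
  proof (rule partition_fun_attains_min[of p0 M ?U])
    show "?Z 0 < \<infinity>" by fact
    show "AE y in M. a \<bullet> ?U y = 0" if "AE y in M. a \<bullet> ?U y \<le> 0" for a
      using rel_interior_moment_two_sided[OF c that] .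
  qed (use p0_pos in \<open>auto intro: that\<close>)
  from min[of 0] have "?Z l < \<infinity>" using \<open>?Z 0 < \<infinity>\<close> by (rule le_less_trans)
  then have l: "l \<in> \<Lambda>" using shifted_partition_fun_finite_iff by blast
  \<comment> \<open>Regularity makes the minimizer an interior point, so small moves in every
    direction stay in the domain.\<close>
  obtain e where e: "0 < e" "ball l e \<subseteq> \<Lambda>"
    using reg l unfolding regular_family_def open_contains_ball by blast
  define w where "w y = p0 y * exp (l \<bullet> ?U y)" for y
  have [measurable]: "w \<in> borel_measurable M" unfolding w_def by measurable
  have w_nonneg: "0 \<le> w y" if "y \<in> space M" for y
    using p0_pos[OF that] by (simp add: w_def)
  have directional: "integrable M (\<lambda>y. w y * (a \<bullet> ?U y))" "0 \<le> (\<integral>y. w y * (a \<bullet> ?U y) \<partial>M)" for a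
  proof -
    \<comment> \<open>Moves \<open>t *\<^sub>R a\<close> with \<open>\<bar>t\<bar> \<le> d\<close>
      stay inside the ball of radius \<open>e\<close>; the added 1 covers
      \<open>a = 0\<close>.\<close>
    define d where "d = e / (norm a + 1)"
    have "0 < norm a + 1" by (simp add: add_nonneg_pos)
    then have d: "0 < d" using e by (simp add: d_def)
    have mem: "l + t *\<^sub>R a \<in> \<Lambda>" if "\<bar>t\<bar> \<le> d" for t
    proof -
      have "\<bar>t\<bar> * norm a \<le> d * norm a" using that by (intro mult_right_mono) auto
      also have "\<dots> < d * (norm a + 1)" using d by simp
      also have "\<dots> = e" using \<open>0 < norm a + 1\<close> by (simp add: d_def)
      finally have "l + t *\<^sub>R a \<in> ball l e" by (simp add: dist_norm)
      then show ?thesis using e by blast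
    qed
    have eq: "w y * exp (t * (a \<bullet> ?U y)) = p0 y * exp ((l + t *\<^sub>R a) \<bullet> ?U y)" for t y
      by (simp add: w_def mult.assoc exp_add[symmetric] inner_add_left)
    have int: "integrable M (\<lambda>y. w y * exp (t * (a \<bullet> ?U y)))"
      and val: "ennreal (\<integral>y. w y * exp (t * (a \<bullet> ?U y)) \<partial>M) = ?Z (l + t *\<^sub>R a)" if "\<bar>t\<bar> \<le> d" for t
    proof -
      have fin: "?Z (l + t *\<^sub>R a) < \<infinity>"
        using mem[OF that] shifted_partition_fun_finite_iff by blast
      have nn: "AE y in M. 0 \<le> w y * exp (t * (a \<bullet> ?U y))"
        using w_nonneg by (intro AE_I2) simp
      have Z: "(\<integral>\<^sup>+ y. ennreal (w y * exp (t * (a \<bullet> ?U y))) \<partial>M) = ?Z (l + t *\<^sub>R a)"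
        unfolding eq partition_fun_def ..
      show int: "integrable M (\<lambda>y. w y * exp (t * (a \<bullet> ?U y)))"
        by (rule integrableI_nonneg[OF _ nn]) (use fin Z in auto)
      show "ennreal (\<integral>y. w y * exp (t * (a \<bullet> ?U y)) \<partial>M) = ?Z (l + t *\<^sub>R a)"
        using nn_integral_eq_integral[OF int nn] Z by simp
    qed
    have le: "(\<integral>y. w y \<partial>M) \<le> (\<integral>y. w y * exp (t * (a \<bullet> ?U y)) \<partial>M)" if "0 < t" "t \<le> d" for t
    proof -
      have "0 \<le> (\<integral>y. w y * exp (t * (a \<bullet> ?U y)) \<partial>M)"
        using w_nonneg by (intro integral_nonneg_AE AE_I2) simp
      moreover have "ennreal (\<integral>y. w y \<partial>M) \<le> ennreal (\<integral>y. w y * exp (t * (a \<bullet> ?U y)) \<partial>M)"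
        using val[of 0] val[of t] d that min by simp
      ultimately show ?thesis by simp
    qed
    show "integrable M (\<lambda>y. w y * (a \<bullet> ?U y))" "0 \<le> (\<integral>y. w y * (a \<bullet> ?U y) \<partial>M)"
      by (rule integral_exp_right_derivative[OF _ _ w_nonneg d int le]; measurable)+
  qed
  let ?f = "\<lambda>y. w y *\<^sub>R ?U y"
  have f: "integrable M ?f"
    by (rule integrable_vec_inner) (use directional(1) in auto)
  have "a \<bullet> (\<integral>y. ?f y \<partial>M) = (\<integral>y. w y * (a \<bullet> ?U y) \<partial>M)" for a
    using integral_inner_right[of a M ?f] f by simp
  then have ge: "0 \<le> a \<bullet> (\<integral>y. ?f y \<partial>M)" for a
    using directional(2)[of a] by simp
  \<comment> \<open>Taking \<open>a\<close> to be minus the integral gives minus its squared norm,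
    which is nonnegative only if the integral is 0.\<close>
  have zero: "(\<integral>y. ?f y \<partial>M) = 0"
    using ge[of "- (\<integral>y. ?f y \<partial>M)"] inner_gt_zero_iff[of "\<integral>y. ?f y \<partial>M"]
    by (auto simp: not_less[symmetric])
  \<comment> \<open>The factor with \<open>P l y = k * w y\<close>: it normalizes and cancels
    \<open>exp (- (l \<bullet> c))\<close> contained in \<open>w\<close>.\<close>
  define k where "k = exp (l \<bullet> c) / enn2real (partition_fun M p0 T l)"
  have eq: "P l y *\<^sub>R T y = k *\<^sub>R ?f y + P l y *\<^sub>R c" for y
  proof -
    have "P l y = k * w y"
      by (simp add: exp_density_def k_def w_def inner_diff_right exp_diff)
    then show ?thesis by (simp add: scaleR_diff_right)
  qed
  have Pc: "integrable M (\<lambda>y. P l y *\<^sub>R c)" "(\<integral>y. P l y *\<^sub>R c \<partial>M) = c"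
    using prob_density_integrable[OF prob_density_exp_density[OF l]]
      prob_density_integral[OF prob_density_exp_density[OF l]] by auto
  have kf: "integrable M (\<lambda>y. k *\<^sub>R ?f y)" "(\<integral>y. k *\<^sub>R ?f y \<partial>M) = 0"
    using f by (auto simp only: integral_scaleR_right zero scaleR_zero_right intro!: integrable_scaleR_right)
  show ?thesis
  proof
    show "P l \<in> moment_set M T c"
      unfolding moment_set_def mem_Collect_eq eq
      using prob_density_exp_density[OF l] Bochner_Integration.integrable_add[OF kf(1) Pc(1)]
        Bochner_Integration.integral_add[OF kf(1) Pc(1)] kf(2) Pc(2) by simp
  qed (rule l)
qed

end

section \<open>Divergence from an empirical distribution\<close>

text \<open>Unifies the discrete and the continuous reading: they differ by a finite constant
  independent of \<open>q\<close>, which cancels in comparisons and identities.\<close>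

lemma KL_empirical_eq_cross_entropy:
  assumes fin: "finite (set_pmf Q)" and sub: "set_pmf Q \<subseteq> space M"
    and pos: "\<And>y. y \<in> space M \<Longrightarrow> 0 < q y"
  shows "KL_empirical M Q q = ereal
    ((if discrete_space M then measure_pmf.expectation Q (\<lambda>y. ln (pmf Q y)) else 0)
      - measure_pmf.expectation Q (\<lambda>y. ln (q y)))"
proof (cases "discrete_space M")
  case True
  let ?f = "\<lambda>y. pmf Q y * ln (pmf Q y / q y)"
  have M: "M = count_space (space M)" using True by (simp add: discrete_space_def)
  have supp: "{y \<in> space M. ?f y \<noteq> 0} \<subseteq> set_pmf Q" by (auto simp: set_pmf_iff)
  have fin': "finite {y \<in> space M. ?f y \<noteq> 0}" by (rule finite_subset[OF supp fin])
  have int: "integrable M ?f"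
  proof -
    \<comment> \<open>Off the support the factor \<open>pmf Q y\<close> is 0, so summability over a
      possibly infinite space reduces to a finite set.\<close>
    have "Infinite_Set_Sum.abs_summable_on ?f (space M)
        \<longleftrightarrow> Infinite_Set_Sum.abs_summable_on ?f (set_pmf Q)"
      by (rule abs_summable_on_cong_neutral) (use sub supp in auto)
    then have "Infinite_Set_Sum.abs_summable_on ?f (space M)" using fin by simp
    then show ?thesis by (subst M) (simp only: abs_summable_on_def)
  qed
  have "(\<integral>y. ?f y \<partial>M) = (\<Sum>y | y \<in> space M \<and> ?f y \<noteq> 0. ?f y)"
    by (subst M, rule lebesgue_integral_count_space_finite_support) (use fin' in simp)
  also have "\<dots> = (\<Sum>y\<in>set_pmf Q. ?f y)"
    using sub supp by (intro sum.mono_neutral_left fin) auto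
  also have "\<dots> = (\<Sum>y\<in>set_pmf Q. ln (pmf Q y) * pmf Q y) - (\<Sum>y\<in>set_pmf Q. ln (q y) * pmf Q y)"
  proof -
    have "?f y = ln (pmf Q y) * pmf Q y - ln (q y) * pmf Q y" if "y \<in> set_pmf Q" for y
      using pos[of y] sub that pmf_positive[OF that] by (auto simp: ln_div algebra_simps)
    then show ?thesis by (simp add: sum_subtractf)
  qed
  also have "\<dots> = measure_pmf.expectation Q (\<lambda>y. ln (pmf Q y)) - measure_pmf.expectation Q (\<lambda>y. ln (q y))"
    using fin by (simp add: integral_measure_pmf_real[of "set_pmf Q"])
  finally show ?thesis
    using True KL_eq_integral[OF pos int] by (simp add: KL_empirical_def)
qed (simp add: KL_empirical_def)

text \<open>The argument of \<open>moment_ln_ratio\<close> with \<open>Q\<close> in place of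
  \<open>r\<close>: \<open>Q\<close> need not have a density, but its finite support makes all
  expectations exist, and it shares its moment with \<open>P l\<close>.\<close>

lemma (in exponential_family) KL_empirical_pythagoras:
  assumes fin: "finite (set_pmf Q)" and sub: "set_pmf Q \<subseteq> space M"
    and l: "l \<in> \<Lambda>" "l' \<in> \<Lambda>"
    and mom: "P l \<in> moment_set M T (measure_pmf.expectation Q T)"
  shows "KL_empirical M Q (P l') = KL_empirical M Q (P l) + KL M (P l) (P l')"
proof -
  let ?k = "log_partition M p0 T l - log_partition M p0 T l'"
  note int = integrable_measure_pmf_finite[OF fin]
  have "measure_pmf.expectation Q (\<lambda>y. ln (P l y)) - measure_pmf.expectation Q (\<lambda>y. ln (P l' y))
      = measure_pmf.expectation Q (\<lambda>y. ln (P l y) - ln (P l' y))"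
    by (simp add: int)
  also have "\<dots> = measure_pmf.expectation Q (\<lambda>y. (l - l') \<bullet> T y - ?k)"
    using sub l
    by (intro integral_cong_AE) (auto simp: AE_measure_pmf_iff ln_exp_density inner_diff_left dest!: subsetD)
  also have "\<dots> = (l - l') \<bullet> measure_pmf.expectation Q T - ?k"
    using integral_inner_right[of "l - l'" "measure_pmf Q" T] by (simp add: int)
  finally show ?thesis
    by (simp add: KL_empirical_eq_cross_entropy[OF fin sub] exp_density_pos l KL_exp_density[OF l mom])
qed

section \<open>Coincidence and uniqueness of the two projections\<close>

theorem proposition4:
  fixes M :: "'a measure" and p0 :: "'a \<Rightarrow> real" and T :: "'a \<Rightarrow> real ^ 'k"
    and n :: nat and x :: "nat \<Rightarrow> 'a" and phat :: "'a pmf" and chat :: "real ^ 'k"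
  assumes "sigma_finite_measure M"
    and "prob_density M p0" and "\<forall>y\<in>space M. 0 < p0 y"
    and "T \<in> borel_measurable M"
    and "1 \<le> n" and "\<forall>i\<in>{1..n}. x i \<in> space M"
    and "phat = empirical n x"
    and "chat = measure_pmf.expectation phat T"
    and "regular_family M p0 T"
    and "minimal_modulo_null M T"
    and "chat \<in> rel_interior (attainable_moments M T)"
    and "\<forall>l. optimal_parameter M p0 T chat l \<longrightarrow>
           (\<forall>\<^sub>F l' in nhds l. partition_fun M p0 T l' < \<infinity>)"
  shows "\<exists>p. p \<in> exp_family M p0 T \<inter> moment_set M T chat
    \<and> (\<forall>q \<in> exp_family M p0 T \<inter> moment_set M T chat. AE y in M. q y = p y)
    \<and> is_e_projection M p0 (moment_set M T chat) p
    \<and> (\<forall>q. is_e_projection M p0 (moment_set M T chat) q \<longrightarrow> (AE y in M. q y = p y))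
    \<and> is_m_projection M phat (exp_family M p0 T) p
    \<and> (\<forall>q. is_m_projection M phat (exp_family M p0 T) q \<longrightarrow> (AE y in M. q y = p y))
    \<and> (\<forall>r \<in> moment_set M T chat. KL M r p0 = KL M r p + KL M p p0)
    \<and> (\<forall>q \<in> exp_family M p0 T.
         KL_empirical M phat q = KL_empirical M phat p + KL M p q)"
proof -
  interpret exponential_family M p0 T
    using assms by unfold_locales auto
  let ?C = "moment_set M T chat"
  obtain l where l: "l \<in> \<Lambda>" and mom: "P l \<in> ?C"
    using ex_exp_density_moment assms by blast
  \<comment> \<open>Nonemptiness is needed for \<open>pmf_of_set\<close> to have this set as its
    support.\<close>
  have "{1..n} \<noteq> {}" using \<open>1 \<le> n\<close> by simp
  then have "set_pmf phat = x ` {1..n}"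
    using assms(7) by (simp add: empirical_def)
  then have phat: "finite (set_pmf phat)" "set_pmf phat \<subseteq> space M"
    using assms(6) by auto
  have pd: "prob_density M r" if "r \<in> ?C" for r
    using that by (simp add: moment_set_def)
  have e_pyth: "KL M r p0 = KL M r (P l) + KL M (P l) p0" if "r \<in> ?C" for r
    using KL_pythagoras[OF l zero_natural mom that] by (simp add: exp_density_0)
  \<comment> \<open>Finiteness allows this term to be cancelled in the extended reals.\<close>
  have e_fin: "\<bar>KL M (P l) p0\<bar> \<noteq> \<infinity>"
    using KL_exp_density[OF l zero_natural mom] by (simp add: exp_density_0)
  have m_pyth: "KL_empirical M phat q = KL_empirical M phat (P l) + KL M (P l) q"
    if "q \<in> exp_family M p0 T" for q
    using that KL_empirical_pythagoras[OF phat l] mom assms(8) by (auto simp: exp_family_def)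
  have m_fin: "\<bar>KL_empirical M phat (P l)\<bar> \<noteq> \<infinity>"
    by (simp add: KL_empirical_eq_cross_entropy[OF phat exp_density_pos[OF l]])
  have e_nonneg: "0 \<le> KL M r (P l)" if "r \<in> ?C" for r
    using KL_nonneg pd[OF that] prob_density_exp_density exp_density_pos l by blast
  have m_nonneg: "0 \<le> KL M (P l) q" if "q \<in> exp_family M p0 T" for q
    using that KL_nonneg pd[OF mom] prob_density_exp_density exp_density_pos
    unfolding exp_family_def by blast
  \<comment> \<open>Comparing a minimizer \<open>q\<close> with \<open>P l\<close> and cancelling
    the finite term leaves \<open>KL M q (P l) \<le> 0\<close>.\<close>
  have e_unique: "AE y in M. q y = P l y" if "is_e_projection M p0 ?C q" for q
  proof -
    have q: "q \<in> ?C" and "\<not> KL M (P l) p0 < KL M q p0"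
      using that mom by (auto simp: is_e_projection_def is_arg_min_def)
    then have "KL M q (P l) \<le> 0"
      using e_pyth[OF q] e_nonneg[OF q] e_fin
      by (cases "KL M q (P l)"; cases "KL M (P l) p0") auto
    then show ?thesis
      using KL_eq_0_imp_AE_eq[OF pd[OF q] prob_density_exp_density[OF l] exp_density_pos[OF l]]
        e_nonneg[OF q] by auto
  qed
  have m_unique: "AE y in M. q y = P l y" if "is_m_projection M phat (exp_family M p0 T) q" for q
  proof -
    have q: "q \<in> exp_family M p0 T" and "\<not> KL_empirical M phat (P l) < KL_empirical M phat q"
      using that l by (auto simp: is_m_projection_def is_arg_min_def exp_family_def)
    then have "KL M (P l) q \<le> 0"
      using m_pyth[OF q] m_nonneg[OF q] m_fin
      by (cases "KL M (P l) q"; cases "KL_empirical M phat (P l)") auto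
    then have "KL M (P l) q = 0" using m_nonneg[OF q] by auto
    moreover obtain l' where "l' \<in> \<Lambda>" "q = P l'" using q by (auto simp: exp_family_def)
    ultimately have "AE y in M. P l y = q y"
      using KL_eq_0_imp_AE_eq[OF pd[OF mom]] prob_density_exp_density exp_density_pos by blast
    then show ?thesis by eventually_elim simp
  qed
  \<comment> \<open>Shown for every member of the intersection, not only \<open>P l\<close>: with
    \<open>e_unique\<close> this gives uniqueness of the intersection.\<close>
  have e_proj: "is_e_projection M p0 ?C q" if q: "q \<in> exp_family M p0 T \<inter> ?C" for q
  proof -
    obtain l' where l': "l' \<in> \<Lambda>" "q = P l'" using q by (auto simp: exp_family_def)
    have "KL M q p0 \<le> KL M r p0" if r: "r \<in> ?C" for r
    proof -
      have "0 \<le> KL M r q"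
        using KL_nonneg pd[OF r] prob_density_exp_density exp_density_pos l' by blast
      moreover have "KL M r p0 = KL M r q + KL M q p0"
        using KL_pythagoras[OF l'(1) zero_natural _ r] q l'(2)
        by (simp add: exp_density_0)
      ultimately show ?thesis by (simp add: ereal_le_add_self2)
    qed
    then show ?thesis
      using q by (auto simp: is_e_projection_def is_arg_min_def not_less)
  qed
  have m_proj: "is_m_projection M phat (exp_family M p0 T) (P l)"
  proof -
    have "KL_empirical M phat (P l) \<le> KL_empirical M phat q" if "q \<in> exp_family M p0 T" for q
      using m_pyth[OF that] m_nonneg[OF that] by (simp add: ereal_le_add_self)
    then show ?thesis
      using l by (auto simp: is_m_projection_def is_arg_min_def not_less exp_family_def)
  qed
  have "P l \<in> exp_family M p0 T \<inter> ?C"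
    using l mom by (auto simp: exp_family_def)
  then show ?thesis
    using e_pyth m_pyth e_unique m_unique e_proj m_proj by blast
qed

end
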